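(* Assume the boundedness condition (constant $\Theta>0$), the existence of the feasible subset $\mathcal{E}$, and the existence of a Slater distribution described in the context. Run the randomized saddle-point algorithm with step sizes $\alpha>0$, $\mu>0$, an arbitrary $P^0\in\mathcal{P}(\mathcal{R})$, $\lambda_1=0$, and an arbitrary sequence of job requests $b^0,b^1,b^2,\ldots\in\mathcal{R}$, and let $\{A^t\}$ be the random reservations generated according to $\{P^t\}$. Then for any $0<\delta<1$, any integer $T>0$ and any integer $1\le K\le T$, the regret $$\tilde R^K_T=\sum_{t=1}^T\big(C_R(A^t)-C_R(A^*_K)\big)$$ satisfies, with probability at least $1-\delta$, $$\tilde R^K_T\le R^K_T+\sqrt{2\log(\delta^{-1})\,T\,\Theta^2},$$ where $R^K_T=\sum_{t=1}^T\big(\mathbb{E}_{P^t}[C_R(A^t)]-\mathbb{E}_{P^K_*}[C_R(A^t)]\big)$ is the deterministic $K$-benchmark regret.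
   Context: **Network model.** There are $N$ servers; server $n$ has $m_n$ resources. $\mathcal{R}_n=\{1,\ldots,m_n\}$, $\mathcal{R}=\prod_{n=1}^N\mathcal{R}_n$. Let $f^R_n,f^V_n,f^T_n$ ($1\le n\le N$) be given positive (nonnegative-valued) functions. For a reservation $a\in\mathcal{R}$ and a job request $b\in\mathcal{R}$, let $\delta_{n,m}=\delta_{n,m}(a,b)$ ($n\ne m$), the number of jobs transferred from server $n$ to server $m$, be a solution of $$\min\sum_{n=1}^N\Big(\sum_{m\ne n}f^T_n(\delta_{n,m})+f^V_n\big(b_n-a_n-\sum_{m\ne n}\delta_{n,m}\big)\Big)\quad\text{s.t. }\delta_{n,m}\le\min\{(b_n-a_n)^+,(a_m-b_m)^+\}\ \forall n\ne m,$$ over nonnegative integers. Costs: reservation cost $C_R(a)=\sum_{n}f^R_n(a_n)$, violation cost $C_V(a,b)=\sum_n f^V_n(b_n-a_n-\sum_{m\neq n}\delta_{n,m})$, transfer cost $C_T(a,b)=\sum_n\sum_{m\ne n}f^T_n(\delta_{n,m})$. A cost threshold $v>0$ is given. (The transfer counts $\delta_{n,m}$ are unrelated to the confidence level $\delta$ of the claim.) **Notation.** $\mathcal{P}(\mathcal{R})=\{P=(p_a)_{a\in\mathcal{R}}\in\mathbb{R}_+^{|\mathcal{R}|}:\sum_a p_a=1\}$. For $P\in\mathcal{P}(\mathcal{R})$ and a function $g$ on $\mathcal{R}$, $\mathbb{E}_P[g(A)]=\sum_{a\in\mathcal{R}}p_a g(a)$ (the superscript on the random reservation $A^t$ inside such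 an expectation plays no role beyond indexing the time slot). $\|\cdot\|$ is the Euclidean norm on $\mathbb{R}^{|\mathcal{R}|}$, and $(x)^+=\max\{0,x\}$. **Assumptions.** (1) There is $\Theta>0$ with $|C_R(a)|\le\Theta$, $|C_T(a,b)|\le\Theta$, $|C_V(a,b)|\le\Theta$ for all $a,b\in\mathcal{R}$. (2) There is a subset $\mathcal{E}\subset\mathcal{P}(\mathcal{R})$ such that for all $P\in\mathcal{E}$, $\mathbb{E}_P[C_V(A,b)+C_T(A,b)]-v\le0$ for all $b\in\mathcal{R}$. (3) There are $\tilde P\in\mathcal{E}$ (a Slater distribution) and $\eta>0$ with $\mathbb{E}_{\tilde P}[C_V(A,b)+C_T(A,b)]-v\le-\eta$ for all $b\in\mathcal{R}$. **Algorithm (randomized saddle-point algorithm).** Given $P^0\in\mathcal{P}(\mathcal{R})$, $b^0\in\mathcal{R}$, $\lambda_1\ge0$, and a fixed job request sequence $(b^t)_{t\ge1}$ in $\mathcal{R}$, for $t=1,2,\ldots$ set $$P^t=\arg\min_{P\in\mathcal{P}(\mathcal{R})}\Big(\tilde{\mathcal{L}}^t(P,\lambda_t)+\frac1{2\alpha}\|P-P^{t-1}\|^2\Big),$$ $$\tilde{\mathcal{L}}^t(P,\lambda)=\mathbb{E}_P[C_R(A)]+\lambda\big(\mathbb{E}_P[C_V(A,b^{t-1})+C_T(A,b^{t-1})]-v\big),$$ $$\lambda_{t+1}=\Big(\lambda_t+\mu\big(\mathbb{E}_{P^t}[C_V(A^t,b^{t-1})+C_T(A^t,b^{t-1})]-v\big)\Big)^+.$$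 At each slot $t$ the reservation $A^t\in\mathcal{R}$ is drawn at random according to $P^t$: conditionally on $A^1,\ldots,A^{t-1}$, $A^t$ has distribution $P^t$. **Benchmarks** (with $b^1,\ldots,b^T$ known in advance, $1\le K\le T$). $A^*_K\in\mathcal{R}$ is an optimal solution of $$\min_{A\in\mathcal{R}}C_R(A)\quad\text{s.t. }\sum_{k=t}^{t+K-1}\big(C_V(A,b^k)+C_T(A,b^k)\big)\le Kv\quad\forall t=1,\ldots,T-K+1,$$ and $P^K_*\in\mathcal{P}(\mathcal{R})$ is an optimal solution of $$\min_{P\in\mathcal{P}(\mathcal{R})}\sum_{t=1}^T\mathbb{E}_P[C_R(A^t)]\quad\text{s.t. }\sum_{k=t}^{t+K-1}\mathbb{E}_P[C_V(A^k,b^k)+C_T(A^k,b^k)]\le Kv\quad\forall t=1,\ldots,T-K+1.$$ *)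

theory Defs
  imports "HOL-Probability.Probability"
begin

record network =
  servers :: nat
  resources :: "nat \<Rightarrow> nat"
  fR :: "nat \<Rightarrow> nat \<Rightarrow> real"
  fV :: "nat \<Rightarrow> int \<Rightarrow> real"
  fT :: "nat \<Rightarrow> nat \<Rightarrow> real"

(* Violation costs take an integer argument: \<open>b n - a n - \<dots>\<close> may be negative. *)
definition nonneg_costs :: "network \<Rightarrow> bool" where
  "nonneg_costs net \<longleftrightarrow>
     (\<forall>n\<in>{1..servers net}.
        (\<forall>k\<in>{1..resources net n}. 0 \<le> fR net n k) \<and>
        (\<forall>z. 0 \<le> fV net n z) \<and> (\<forall>k. 0 \<le> fT net n k))"

definition profiles :: "network \<Rightarrow> (nat \<Rightarrow> nat) set" where
  "profiles net = (\<Pi>\<^sub>E n\<in>{1..servers net}. {1..resources net n})"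

definition reservation_cost :: "network \<Rightarrow> (nat \<Rightarrow> nat) \<Rightarrow> real" where
  "reservation_cost net a = (\<Sum>n=1..servers net. fR net n (a n))"

(* In the next definitions d n m, for n \<noteq> m, is the number of jobs moved from server n
   to server m; the diagonal entries of d play no role. *)
definition plan_violation ::
    "network \<Rightarrow> (nat \<Rightarrow> nat) \<Rightarrow> (nat \<Rightarrow> nat) \<Rightarrow> (nat \<Rightarrow> nat \<Rightarrow> nat) \<Rightarrow> real" where
  "plan_violation net a b d =
     (\<Sum>n=1..servers net. fV net n (int (b n) - int (a n) - (\<Sum>m\<in>{1..servers net} - {n}. int (d n m))))"

definition plan_transfer :: "network \<Rightarrow> (nat \<Rightarrow> nat \<Rightarrow> nat) \<Rightarrow> real" where
  "plan_transfer net d =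
     (\<Sum>n=1..servers net. \<Sum>m\<in>{1..servers net} - {n}. fT net n (d n m))"

definition feasible_plan ::
    "network \<Rightarrow> (nat \<Rightarrow> nat) \<Rightarrow> (nat \<Rightarrow> nat) \<Rightarrow> (nat \<Rightarrow> nat \<Rightarrow> nat) \<Rightarrow> bool" where
  "feasible_plan net a b d \<longleftrightarrow>
     (\<forall>n\<in>{1..servers net}. \<forall>m\<in>{1..servers net} - {n}.
        int (d n m) \<le> min (max 0 (int (b n) - int (a n))) (max 0 (int (a m) - int (b m))))"

definition optimal_plan ::
    "network \<Rightarrow> (nat \<Rightarrow> nat) \<Rightarrow> (nat \<Rightarrow> nat) \<Rightarrow> (nat \<Rightarrow> nat \<Rightarrow> nat) \<Rightarrow> bool" where
  "optimal_plan net a b d \<longleftrightarrow>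
     is_arg_min
       (\<lambda>d. \<Sum>n=1..servers net.
          (\<Sum>m\<in>{1..servers net} - {n}. fT net n (d n m)) +
          fV net n (int (b n) - int (a n) - (\<Sum>m\<in>{1..servers net} - {n}. int (d n m))))
       (feasible_plan net a b) d"

(* D a b is the transfer plan chosen for reservation a and request b. *)
type_synonym transfer_rule = "(nat \<Rightarrow> nat) \<Rightarrow> (nat \<Rightarrow> nat) \<Rightarrow> nat \<Rightarrow> nat \<Rightarrow> nat"

definition violation_cost ::
    "network \<Rightarrow> transfer_rule \<Rightarrow> (nat \<Rightarrow> nat) \<Rightarrow> (nat \<Rightarrow> nat) \<Rightarrow> real" where
  "violation_cost net D a b = plan_violation net a b (D a b)"

definition transfer_cost ::
    "network \<Rightarrow> transfer_rule \<Rightarrow> (nat \<Rightarrow> nat) \<Rightarrow> (nat \<Rightarrow> nat) \<Rightarrow> real" where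
  "transfer_cost net D a b = plan_transfer net (D a b)"

definition distributions :: "network \<Rightarrow> ((nat \<Rightarrow> nat) \<Rightarrow> real) set" where
  "distributions net =
     {p \<in> profiles net \<rightarrow>\<^sub>E {0..}. (\<Sum>a\<in>profiles net. p a) = 1}"

definition expect ::
    "network \<Rightarrow> ((nat \<Rightarrow> nat) \<Rightarrow> real) \<Rightarrow> ((nat \<Rightarrow> nat) \<Rightarrow> real) \<Rightarrow> real" where
  "expect net p g = (\<Sum>a\<in>profiles net. p a * g a)"

definition expect_VT ::
    "network \<Rightarrow> transfer_rule \<Rightarrow> ((nat \<Rightarrow> nat) \<Rightarrow> real) \<Rightarrow> (nat \<Rightarrow> nat) \<Rightarrow> real" where
  "expect_VT net D p b = expect net p (\<lambda>a. violation_cost net D a b + transfer_cost net D a b)"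

(* b is the most recent request, i.e. the request of slot t - 1 when used in slot t. *)
definition lagrangian ::
    "network \<Rightarrow> transfer_rule \<Rightarrow> real \<Rightarrow> (nat \<Rightarrow> nat) \<Rightarrow> ((nat \<Rightarrow> nat) \<Rightarrow> real) \<Rightarrow> real \<Rightarrow> real" where
  "lagrangian net D v b p l =
     expect net p (reservation_cost net) + l * (expect_VT net D p b - v)"

(* P is indexed from 0 and lam from 1; lam 0 is unused. *)
definition saddle_point_run ::
    "network \<Rightarrow> transfer_rule \<Rightarrow> real \<Rightarrow> real \<Rightarrow> real \<Rightarrow> (nat \<Rightarrow> nat \<Rightarrow> nat) \<Rightarrow>
     (nat \<Rightarrow> (nat \<Rightarrow> nat) \<Rightarrow> real) \<Rightarrow> (nat \<Rightarrow> real) \<Rightarrow> bool" where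
  "saddle_point_run net D v \<alpha> \<mu> b P lam \<longleftrightarrow>
     P 0 \<in> distributions net \<and>
     (\<forall>t\<ge>1.
        is_arg_min
          (\<lambda>p. lagrangian net D v (b (t - 1)) p (lam t)
                + 1 / (2 * \<alpha>) * (L2_set (\<lambda>a. p a - P (t - 1) a) (profiles net))\<^sup>2)
          (\<lambda>p. p \<in> distributions net) (P t) \<and>
        lam (t + 1) = max 0 (lam t + \<mu> * (expect_VT net D (P t) (b (t - 1)) - v)))"

(* The elementary conditional law of A t given A 1, ..., A (t - 1), on histories h of
   positive probability. *)
definition generated_reservations ::
    "network \<Rightarrow> (nat \<Rightarrow> (nat \<Rightarrow> nat) \<Rightarrow> real) \<Rightarrow> 'w measure \<Rightarrow> (nat \<Rightarrow> 'w \<Rightarrow> nat \<Rightarrow> nat) \<Rightarrow> bool" where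
  "generated_reservations net P M A \<longleftrightarrow>
     (\<forall>t\<ge>1. A t \<in> measurable M (count_space (profiles net))) \<and>
     (\<forall>t\<ge>1. \<forall>h. \<forall>a\<in>profiles net.
        \<P>(w in M. \<forall>s\<in>{1..<t}. A s w = h s) > 0 \<longrightarrow>
        \<P>(w in M. A t w = a \<bar> \<forall>s\<in>{1..<t}. A s w = h s) = P t a)"

definition benchmark_action ::
    "network \<Rightarrow> transfer_rule \<Rightarrow> real \<Rightarrow> (nat \<Rightarrow> nat \<Rightarrow> nat) \<Rightarrow> nat \<Rightarrow> nat \<Rightarrow> (nat \<Rightarrow> nat) \<Rightarrow> bool" where
  "benchmark_action net D v b T K astar \<longleftrightarrow>
     is_arg_min (reservation_cost net)
       (\<lambda>a. a \<in> profiles net \<and>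
          (\<forall>t\<in>{1..T - K + 1}.
             (\<Sum>k\<in>{t..t + K - 1}. violation_cost net D a (b k) + transfer_cost net D a (b k))
               \<le> real K * v)) astar"

definition benchmark_distribution ::
    "network \<Rightarrow> transfer_rule \<Rightarrow> real \<Rightarrow> (nat \<Rightarrow> nat \<Rightarrow> nat) \<Rightarrow> nat \<Rightarrow> nat \<Rightarrow>
     ((nat \<Rightarrow> nat) \<Rightarrow> real) \<Rightarrow> bool" where
  "benchmark_distribution net D v b T K pstar \<longleftrightarrow>
     is_arg_min (\<lambda>p. \<Sum>t=1..T. expect net p (reservation_cost net))
       (\<lambda>p. p \<in> distributions net \<and>
          (\<forall>t\<in>{1..T - K + 1}. (\<Sum>k=t..t + K - 1. expect_VT net D p (b k)) \<le> real K * v)) pstar"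

definition expected_regret ::
    "network \<Rightarrow> (nat \<Rightarrow> (nat \<Rightarrow> nat) \<Rightarrow> real) \<Rightarrow> ((nat \<Rightarrow> nat) \<Rightarrow> real) \<Rightarrow> nat \<Rightarrow> real" where
  "expected_regret net P Pstar T =
     (\<Sum>t=1..T. expect net (P t) (reservation_cost net) - expect net Pstar (reservation_cost net))"

definition realized_regret ::
    "network \<Rightarrow> (nat \<Rightarrow> nat \<Rightarrow> nat) \<Rightarrow> (nat \<Rightarrow> nat) \<Rightarrow> nat \<Rightarrow> real" where
  "realized_regret net a astar T =
     (\<Sum>t=1..T. reservation_cost net (a t) - reservation_cost net astar)"

end

theory Submission
  imports Defs
begin

text \<open>
  Two facts add up to the bound.

  The realized cost concentrates around its mean. Since the requests are fixed, the algorithm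
  computes the distributions \<open>P t\<close> without looking at the random reservations. The
  conditional law of \<open>A t\<close> given the past is therefore the same for every past, and a
  constant conditional law means independence: \<open>A 1\<close>, ..., \<open>A T\<close> are independent with
  \<open>A t\<close> distributed according to \<open>P t\<close> (\<open>prob_reservation\<close>, \<open>indep_reservations\<close>). So the
  martingale inequality of Azuma, the tool for a general adaptive algorithm, reduces
  to Hoeffding's inequality for independent variables with values in the interval from
  \<open>- \<Theta>\<close> to \<open>\<Theta>\<close>. The sum of the squared widths is \<open>4 T \<Theta>\<^sup>2\<close>, and the tail
  \<open>exp (- 2 \<epsilon>\<^sup>2 / (4 T \<Theta>\<^sup>2))\<close> equals \<open>\<delta>\<close> exactly for
  \<open>\<epsilon>\<^sup>2 = 2 ln (1 / \<delta>) T \<Theta>\<^sup>2\<close>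
  (\<open>sum_reservations_concentration\<close>).

  The randomized benchmark is at least as good as the deterministic one: the point mass at
  \<open>Astar\<close> satisfies the constraints of the problem that \<open>Pstar\<close> solves, so the expected cost
  under \<open>Pstar\<close> is at most the cost of \<open>Astar\<close> (\<open>benchmark_distribution_le_action\<close>).
  Replacing \<open>Astar\<close> by \<open>Pstar\<close> thus can only increase the regret.
\<close>

section \<open>Finitely valued random variables\<close>

context prob_space
begin

lemma events_eq_count_space:
  assumes "X \<in> measurable M (count_space S)" "a \<in> S"
  shows "{w \<in> space M. X w = a} \<in> events"
  using measurable_sets[OF assms(1), of "{a}"] assms(2) by (simp add: vimage_def Int_def conj_commute)

lemma events_in_count_space:
  assumes "X \<in> measurable M (count_space S)" "B \<subseteq> S"
  shows "{w \<in> space M. X w \<in> B} \<in> events"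
  using measurable_sets[OF assms(1), of B] assms(2) by (simp add: vimage_def Int_def conj_commute)

lemma expectation_finite_range:
  fixes f :: "'b \<Rightarrow> real"
  assumes S: "finite S" and X: "X \<in> measurable M (count_space S)"
  shows "expectation (\<lambda>w. f (X w)) = (\<Sum>a\<in>S. \<P>(w in M. X w = a) * f a)"
proof -
  note ev = events_eq_count_space[OF X]
  have "expectation (\<lambda>w. f (X w))
      = expectation (\<lambda>w. \<Sum>a\<in>S. indicator {w \<in> space M. X w = a} w * f a)"
  proof (intro Bochner_Integration.integral_cong refl)
    fix w assume w: "w \<in> space M"
    then have "X w \<in> S"
      using measurable_space[OF X] by simp
    have "(\<Sum>a\<in>S. indicator {w \<in> space M. X w = a} w * f a) = (\<Sum>a\<in>S. if X w = a then f a else 0)"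
      by (intro sum.cong) (auto simp: w)
    also have "\<dots> = f (X w)"
      using S \<open>X w \<in> S\<close> by simp
    finally show "f (X w) = (\<Sum>a\<in>S. indicator {w \<in> space M. X w = a} w * f a)" ..
  qed
  also have "\<dots> = (\<Sum>a\<in>S. expectation (\<lambda>w. indicator {w \<in> space M. X w = a} w * f a))"
    using ev by (intro Bochner_Integration.integral_sum) (auto simp: emeasure_eq_measure)
  also have "\<dots> = (\<Sum>a\<in>S. \<P>(w in M. X w = a) * f a)"
    by (intro sum.cong) (auto simp: Int_def intro!: arg_cong[where f = prob])
  finally show ?thesis .
qed

lemma prob_in_finite_range:
  assumes S: "finite S" and X: "X \<in> measurable M (count_space S)" and B: "B \<subseteq> S"
  shows "\<P>(w in M. X w \<in> B) = (\<Sum>a\<in>B. \<P>(w in M. X w = a))"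
proof (rule prob_sum)
  show "{w \<in> space M. X w \<in> B} \<in> events"
    by (rule events_in_count_space[OF X B])
  show "{w \<in> space M. X w = a} \<in> events" if "a \<in> B" for a
    using that B by (intro events_eq_count_space[OF X]) auto
qed (use finite_subset[OF B S] in auto)

text \<open>
  Independence asks for the product rule on all boxes of events. On a finite range a box is a
  finite disjoint union of points, and expanding the product of the marginal sums by
  distributivity gives one summand for each point of the box. Hence point masses suffice.
\<close>

lemma indep_vars_finite_rangeI:
  fixes X :: "'i \<Rightarrow> 'a \<Rightarrow> 'b"
  assumes I: "finite I" "I \<noteq> {}" and S: "finite S"
    and X: "\<And>i. i \<in> I \<Longrightarrow> X i \<in> measurable M (count_space S)"
    and joint: "\<And>h. h \<in> (\<Pi>\<^sub>E i\<in>I. S) \<Longrightarrow>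
      \<P>(w in M. \<forall>i\<in>I. X i w = h i) = (\<Prod>i\<in>I. \<P>(w in M. X i w = h i))"
  shows "indep_vars (\<lambda>_. count_space S) X I"
proof -
  have box: "prob (\<Inter>i\<in>I. X i -` B i \<inter> space M) = (\<Prod>i\<in>I. prob (X i -` B i \<inter> space M))"
    if B: "B \<in> (\<Pi> i\<in>I. Pow S)" for B
  proof -
    have BS: "B i \<subseteq> S" if "i \<in> I" for i
      using B that by auto
    then have finB: "finite (B i)" if "i \<in> I" for i
      using S that finite_subset by blast
    have "(\<Inter>i\<in>I. X i -` B i \<inter> space M) = {w \<in> space M. \<forall>i\<in>I. X i w \<in> B i}"
      using I by auto
    then have "prob (\<Inter>i\<in>I. X i -` B i \<inter> space M) = \<P>(w in M. \<forall>i\<in>I. X i w \<in> B i)"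
      by simp
    also have "\<dots> = (\<Sum>h\<in>Pi\<^sub>E I B. \<P>(w in M. \<forall>i\<in>I. X i w = h i))"
    proof (rule prob_sum)
      show "finite (Pi\<^sub>E I B)"
        using I finB by (intro finite_PiE) auto
      show "{w \<in> space M. \<forall>i\<in>I. X i w \<in> B i} \<in> events"
        using I X BS
        by (intro sets.sets_Collect_finite_All events_in_count_space[where S = S]) auto
      show "{w \<in> space M. \<forall>i\<in>I. X i w = h i} \<in> events" if "h \<in> Pi\<^sub>E I B" for h
        using I X that BS
        by (intro sets.sets_Collect_finite_All events_eq_count_space[where S = S]) (auto simp: PiE_iff)
      have "\<exists>!h. h \<in> Pi\<^sub>E I B \<and> (\<forall>i\<in>I. X i w = h i)" if "\<forall>i\<in>I. X i w \<in> B i" for w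
      proof (rule ex1I[of _ "\<lambda>i\<in>I. X i w"])
        show "h = (\<lambda>i\<in>I. X i w)" if "h \<in> Pi\<^sub>E I B \<and> (\<forall>i\<in>I. X i w = h i)" for h
          using that by (auto intro!: PiE_ext[of h I B])
      qed (use that in auto)
      then show "AE w in M. (\<forall>h\<in>Pi\<^sub>E I B. (\<forall>i\<in>I. X i w = h i) \<longrightarrow> (\<forall>i\<in>I. X i w \<in> B i)) \<and>
          ((\<forall>i\<in>I. X i w \<in> B i) \<longrightarrow> (\<exists>!h. h \<in> Pi\<^sub>E I B \<and> (\<forall>i\<in>I. X i w = h i)))"
        by (intro AE_I2) (auto simp: PiE_iff)
    qed
    also have "\<dots> = (\<Sum>h\<in>Pi\<^sub>E I B. \<Prod>i\<in>I. \<P>(w in M. X i w = h i))"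
      using BS by (intro sum.cong refl joint) (auto simp: PiE_iff)
    also have "\<dots> = (\<Prod>i\<in>I. \<Sum>a\<in>B i. \<P>(w in M. X i w = a))"
      using I finB by (subst prod_sum_PiE) auto
    also have "\<dots> = (\<Prod>i\<in>I. prob (X i -` B i \<inter> space M))"
      using prob_in_finite_range[OF S X BS]
      by (intro prod.cong) (auto simp: vimage_def Int_def conj_commute)
    finally show ?thesis .
  qed
  show ?thesis
  proof (subst indep_vars_finite[where E = "\<lambda>_. Pow S"])
    show "sets (count_space S) = sigma_sets (space (count_space S)) (Pow S)"
      using sigma_algebra.sigma_sets_eq[OF sigma_algebra_Pow, of S] by simp
  qed (use I X box in \<open>auto simp: Int_stable_def\<close>)
qed

end

section \<open>Reservations drawn from a deterministic sequence of distributions\<close>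

lemma finite_profiles: "finite (profiles net)"
  unfolding profiles_def by (intro finite_PiE) auto

text \<open>
  The chain rule in product form holds for impossible histories too, although the
  conditional law of the next reservation is prescribed only after histories of positive
  probability: if the history has probability zero, so does each of its extensions.
\<close>

lemma prob_extend_history:
  assumes M: "prob_space M" and gen: "generated_reservations net P M A"
    and t: "t \<ge> 1" and a: "a \<in> profiles net"
    and h: "h \<in> {1..<t} \<rightarrow> profiles net"
  shows "\<P>(w in M. A t w = a \<and> (\<forall>s\<in>{1..<t}. A s w = h s))
       = P t a * \<P>(w in M. \<forall>s\<in>{1..<t}. A s w = h s)"
proof -
  interpret prob_space M by (fact M)
  have X: "A s \<in> measurable M (count_space (profiles net))" if "s \<ge> 1" for s
    using gen that by (simp add: generated_reservations_def)
  have hist: "{w \<in> space M. \<forall>s\<in>{1..<t}. A s w = h s} \<in> events"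
    using h
    by (intro sets.sets_Collect_finite_All events_eq_count_space[OF X]) auto
  show ?thesis
  proof (cases "\<P>(w in M. \<forall>s\<in>{1..<t}. A s w = h s) > 0")
    case True
    then have "\<P>(w in M. A t w = a \<bar> \<forall>s\<in>{1..<t}. A s w = h s) = P t a"
      using gen t a by (auto simp: generated_reservations_def)
    with True show ?thesis
      by (simp add: cond_prob_def field_simps)
  next
    case False
    then have zero: "\<P>(w in M. \<forall>s\<in>{1..<t}. A s w = h s) = 0"
      by (simp add: zero_less_measure_iff)
    have "\<P>(w in M. A t w = a \<and> (\<forall>s\<in>{1..<t}. A s w = h s))
        \<le> \<P>(w in M. \<forall>s\<in>{1..<t}. A s w = h s)"
      using hist by (intro finite_measure_mono) auto
    with zero show ?thesis
      by (simp add: measure_le_0_iff)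
  qed
qed

text \<open>
  The conditional probability \<open>P t a\<close> does not depend on the history, so averaging it over all
  histories of the slots before \<open>t\<close> leaves it unchanged.
\<close>

lemma prob_reservation:
  assumes M: "prob_space M" and gen: "generated_reservations net P M A"
    and t: "t \<ge> 1" and a: "a \<in> profiles net"
  shows "\<P>(w in M. A t w = a) = P t a"
proof -
  interpret prob_space M by (fact M)
  let ?H = "\<Pi>\<^sub>E s\<in>{1..<t}. profiles net"
  have X: "A s \<in> measurable M (count_space (profiles net))" if "s \<ge> 1" for s
    using gen that by (simp add: generated_reservations_def)
  have hist: "{w \<in> space M. \<forall>s\<in>{1..<t}. A s w = h s} \<in> events" if "h \<in> ?H" for h
    using that
    by (intro sets.sets_Collect_finite_All events_eq_count_space[OF X]) auto
  have finH: "finite ?H"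
    using finite_profiles by (intro finite_PiE) auto
  have ex1: "\<exists>!h. h \<in> ?H \<and> (\<forall>s\<in>{1..<t}. A s w = h s)" if w: "w \<in> space M" for w
  proof (rule ex1I[of _ "\<lambda>s\<in>{1..<t}. A s w"])
    show "h = (\<lambda>s\<in>{1..<t}. A s w)" if "h \<in> ?H \<and> (\<forall>s\<in>{1..<t}. A s w = h s)" for h
      using that by (auto intro!: PiE_ext[of h "{1..<t}" "\<lambda>_. profiles net"])
  qed (use measurable_space[OF X w] in auto)
  have total: "(\<Sum>h\<in>?H. \<P>(w in M. \<forall>s\<in>{1..<t}. A s w = h s)) = 1"
  proof -
    have "\<P>(w in M. True) = (\<Sum>h\<in>?H. \<P>(w in M. \<forall>s\<in>{1..<t}. A s w = h s))"
      using finH hist ex1 by (intro prob_sum) (auto intro!: AE_I2)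
    then show ?thesis by (simp add: prob_space)
  qed
  have "\<P>(w in M. A t w = a)
      = (\<Sum>h\<in>?H. \<P>(w in M. A t w = a \<and> (\<forall>s\<in>{1..<t}. A s w = h s)))"
  proof (rule prob_sum)
    show "{w \<in> space M. A t w = a \<and> (\<forall>s\<in>{1..<t}. A s w = h s)} \<in> events" if "h \<in> ?H" for h
      by (intro sets.sets_Collect_conj events_eq_count_space[OF X[OF t] a] hist[OF that])
    show "AE w in M. (\<forall>h\<in>?H. A t w = a \<and> (\<forall>s\<in>{1..<t}. A s w = h s) \<longrightarrow> A t w = a) \<and>
      (A t w = a \<longrightarrow> (\<exists>!h. h \<in> ?H \<and> A t w = a \<and> (\<forall>s\<in>{1..<t}. A s w = h s)))"
      using ex1 by (intro AE_I2) auto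
  qed (use finH events_eq_count_space[OF X[OF t] a] in auto)
  also have "\<dots> = (\<Sum>h\<in>?H. P t a * \<P>(w in M. \<forall>s\<in>{1..<t}. A s w = h s))"
    by (intro sum.cong refl prob_extend_history[OF M gen t a]) auto
  also have "\<dots> = P t a"
    using total by (simp flip: sum_distrib_left)
  finally show ?thesis .
qed

lemma prob_history:
  assumes M: "prob_space M" and gen: "generated_reservations net P M A"
    and h: "h \<in> {1..n} \<rightarrow> profiles net"
  shows "\<P>(w in M. \<forall>s\<in>{1..n}. A s w = h s) = (\<Prod>s=1..n. P s (h s))"
  using h
proof (induction n)
  case 0
  interpret prob_space M by (fact M)
  show ?case by (simp add: prob_space)
next
  case (Suc n)
  have set: "{1..<Suc n} = {1..n}" "{1..Suc n} = insert (Suc n) {1..n}"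
    by auto
  have h: "h (Suc n) \<in> profiles net" "h \<in> {1..n} \<rightarrow> profiles net"
    using Suc.prems by auto
  have "\<P>(w in M. \<forall>s\<in>{1..Suc n}. A s w = h s)
      = \<P>(w in M. A (Suc n) w = h (Suc n) \<and> (\<forall>s\<in>{1..<Suc n}. A s w = h s))"
    unfolding set by simp
  also have "\<dots> = P (Suc n) (h (Suc n)) * \<P>(w in M. \<forall>s\<in>{1..n}. A s w = h s)"
    using prob_extend_history[OF M gen, of "Suc n" "h (Suc n)" h] h unfolding set by simp
  also have "\<P>(w in M. \<forall>s\<in>{1..n}. A s w = h s) = (\<Prod>s=1..n. P s (h s))"
    by (rule Suc.IH[OF h(2)])
  finally show ?case by (simp add: mult.commute)
qed

lemma indep_reservations:
  assumes M: "prob_space M" and gen: "generated_reservations net P M A" and T: "T > 0"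
  shows "prob_space.indep_vars M (\<lambda>_. count_space (profiles net)) A {1..T}"
proof -
  interpret prob_space M by (fact M)
  show ?thesis
  proof (rule indep_vars_finite_rangeI)
    show "\<P>(w in M. \<forall>t\<in>{1..T}. A t w = h t) = (\<Prod>t\<in>{1..T}. \<P>(w in M. A t w = h t))"
      if h: "h \<in> (\<Pi>\<^sub>E t\<in>{1..T}. profiles net)" for h
    proof -
      have "\<P>(w in M. \<forall>t\<in>{1..T}. A t w = h t) = (\<Prod>t=1..T. P t (h t))"
        using h by (intro prob_history[OF M gen]) auto
      also have "\<dots> = (\<Prod>t\<in>{1..T}. \<P>(w in M. A t w = h t))"
        using h by (intro prod.cong refl prob_reservation[OF M gen, symmetric]) auto
      finally show ?thesis .
    qed
  qed (use T finite_profiles gen in \<open>auto simp: generated_reservations_def\<close>)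
qed

section \<open>Concentration of the realized reservation cost\<close>

text \<open>
  The confidence term comes out with the factor \<open>2\<close> under the root because each summand ranges
  over an interval of width \<open>2 \<Theta>\<close>.
\<close>

lemma sum_reservations_concentration:
  assumes M: "prob_space M" and gen: "generated_reservations net P M A"
    and g: "\<And>a. a \<in> profiles net \<Longrightarrow> \<bar>g a\<bar> \<le> \<Theta>"
    and \<Theta>: "\<Theta> > 0" and T: "T > 0" and \<delta>: "0 < \<delta>" "\<delta> < 1"
  shows "\<P>(w in M. (\<Sum>t=1..T. g (A t w))
            \<le> (\<Sum>t=1..T. expect net (P t) g) + sqrt (2 * ln (1 / \<delta>) * real T * \<Theta>\<^sup>2)) \<ge> 1 - \<delta>"
proof -
  interpret prob_space M by (fact M)
  define \<epsilon> where "\<epsilon> = sqrt (2 * ln (1 / \<delta>) * real T * \<Theta>\<^sup>2)"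
  have ln_nonneg: "ln (1 / \<delta>) \<ge> 0"
    using \<delta> by simp
  have \<epsilon>: "\<epsilon> \<ge> 0" "\<epsilon>\<^sup>2 = 2 * ln (1 / \<delta>) * real T * \<Theta>\<^sup>2"
    using ln_nonneg by (simp_all add: \<epsilon>_def)
  have X: "A t \<in> measurable M (count_space (profiles net))" if "t \<in> {1..T}" for t
    using gen that by (simp add: generated_reservations_def)
  have indep: "indep_vars (\<lambda>_. borel) (\<lambda>t w. g (A t w)) {1..T}"
    using indep_vars_compose2[OF indep_reservations[OF M gen T], of "\<lambda>_. g" "\<lambda>_. borel"] by simp
  interpret Hoeffding_ineq M "{1..T}" "\<lambda>t w. g (A t w)" "\<lambda>_. - \<Theta>" "\<lambda>_. \<Theta>"
      "\<Sum>t\<in>{1..T}. expectation (\<lambda>w. g (A t w))"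
  proof unfold_locales
    show "AE w in M. g (A t w) \<in> {- \<Theta>..\<Theta>}" if "t \<in> {1..T}" for t
    proof (rule AE_I2)
      fix w assume "w \<in> space M"
      then have "A t w \<in> profiles net"
        using measurable_space[OF X[OF that]] by simp
      from g[OF this] show "g (A t w) \<in> {- \<Theta>..\<Theta>}"
        by (simp add: abs_le_iff)
    qed
  qed (use indep in simp_all)
  have mean: "(\<Sum>t\<in>{1..T}. expectation (\<lambda>w. g (A t w))) = (\<Sum>t=1..T. expect net (P t) g)"
  proof (intro sum.cong refl)
    fix t assume t: "t \<in> {1..T}"
    show "expectation (\<lambda>w. g (A t w)) = expect net (P t) g"
      unfolding expect_def expectation_finite_range[OF finite_profiles X[OF t]]
      using t by (intro sum.cong refl) (simp add: prob_reservation[OF M gen])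
  qed
  let ?m = "\<Sum>t=1..T. expect net (P t) g"
  have width: "(\<Sum>t\<in>{1..T}. (\<Theta> - - \<Theta>)\<^sup>2) = 4 * real T * \<Theta>\<^sup>2"
    by (simp add: power2_eq_square)
  have "prob {w \<in> space M. (\<Sum>t=1..T. g (A t w)) \<ge> ?m + \<epsilon>} \<le> exp (- 2 * \<epsilon>\<^sup>2 / (4 * real T * \<Theta>\<^sup>2))"
    using Hoeffding_ineq_ge[OF \<epsilon>(1)] T \<Theta> unfolding width mean by simp
  also have "- 2 * \<epsilon>\<^sup>2 / (4 * real T * \<Theta>\<^sup>2) = - ln (1 / \<delta>)"
    using T \<Theta> unfolding \<epsilon>(2) by (simp add: field_simps)
  also have "exp (- ln (1 / \<delta>)) = \<delta>"
    using \<delta> by (simp add: ln_div)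
  finally have tail: "prob {w \<in> space M. (\<Sum>t=1..T. g (A t w)) \<ge> ?m + \<epsilon>} \<le> \<delta>" .
  have [measurable]: "(\<lambda>w. \<Sum>t=1..T. g (A t w)) \<in> borel_measurable M"
    using random_variable by (intro borel_measurable_sum) auto
  \<comment> \<open>Hoeffding's inequality bounds the event of reaching the threshold; its complement is the
    strict inequality, which is slightly stronger than required.\<close>
  have "1 - \<delta> \<le> 1 - prob {w \<in> space M. (\<Sum>t=1..T. g (A t w)) \<ge> ?m + \<epsilon>}"
    using tail by simp
  also have "\<dots> = prob {w \<in> space M. \<not> (\<Sum>t=1..T. g (A t w)) \<ge> ?m + \<epsilon>}"
    by (intro prob_neg[symmetric]) measurable
  also have "\<dots> \<le> prob {w \<in> space M. (\<Sum>t=1..T. g (A t w)) \<le> ?m + \<epsilon>}"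
    by (intro finite_measure_mono) (auto, measurable)
  finally show ?thesis
    by (simp add: \<epsilon>_def)
qed

section \<open>Comparison of the two benchmarks\<close>

text \<open>
  A deterministic reservation is a special case of a randomized one, namely a point mass, and
  under a point mass the expected costs in the windowed constraints and in the objective are
  the costs of that reservation. So the randomized problem is a relaxation. The factor
  \<open>real T\<close> stays because the objective is a sum over the slots, which says nothing about
  \<open>Pstar\<close> if \<open>T = 0\<close>.
\<close>

lemma benchmark_distribution_le_action:
  assumes act: "benchmark_action net D v b T K Astar"
    and dist: "benchmark_distribution net D v b T K Pstar"
  shows "real T * expect net Pstar (reservation_cost net) \<le> real T * reservation_cost net Astar"
proof -
  \<comment> \<open>The restriction makes the point mass extensional, as membership in \<^const>\<open>distributions\<close> demands.\<close>
  define p where "p = (\<lambda>a\<in>profiles net. if a = Astar then 1 else (0 :: real))"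
  have Astar: "Astar \<in> profiles net"
    and feas: "\<And>t. t \<in> {1..T - K + 1} \<Longrightarrow>
      (\<Sum>k\<in>{t..t + K - 1}. violation_cost net D Astar (b k) + transfer_cost net D Astar (b k)) \<le> real K * v"
    using act by (auto simp: benchmark_action_def is_arg_min_def)
  have p_expect: "expect net p g = g Astar" for g
  proof -
    have "expect net p g = (\<Sum>a\<in>profiles net. if a = Astar then g a else 0)"
      unfolding expect_def by (intro sum.cong) (auto simp: p_def)
    then show ?thesis
      using Astar finite_profiles by simp
  qed
  have "p \<in> distributions net"
    using Astar finite_profiles by (auto simp: distributions_def p_def)
  moreover have "\<forall>t\<in>{1..T - K + 1}. (\<Sum>k=t..t + K - 1. expect_VT net D p (b k)) \<le> real K * v"
    using feas by (simp add: expect_VT_def p_expect)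
  ultimately have "(\<Sum>t=1..T. expect net Pstar (reservation_cost net))
      \<le> (\<Sum>t=1..T. expect net p (reservation_cost net))"
    using dist unfolding benchmark_distribution_def is_arg_min_def by (meson not_less)
  then show ?thesis
    by (simp add: p_expect)
qed

theorem corollaryV1:
  fixes net :: network
    and D :: transfer_rule
    and v \<Theta> \<eta> \<alpha> \<mu> \<delta> :: real
    and \<E> :: "((nat \<Rightarrow> nat) \<Rightarrow> real) set"
    and Pslater Pstar :: "(nat \<Rightarrow> nat) \<Rightarrow> real"
    and b :: "nat \<Rightarrow> nat \<Rightarrow> nat"
    and P :: "nat \<Rightarrow> (nat \<Rightarrow> nat) \<Rightarrow> real"
    and lam :: "nat \<Rightarrow> real"
    and M :: "'w measure"
    and A :: "nat \<Rightarrow> 'w \<Rightarrow> nat \<Rightarrow> nat"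
    and Astar :: "nat \<Rightarrow> nat"
    and T K :: nat
  assumes costs: "nonneg_costs net"
    and plan: "\<And>a c. a \<in> profiles net \<Longrightarrow> c \<in> profiles net \<Longrightarrow> optimal_plan net a c (D a c)"
    and threshold: "v > 0"
    and Theta_pos: "\<Theta> > 0"
    and bound_R: "\<And>a. a \<in> profiles net \<Longrightarrow> \<bar>reservation_cost net a\<bar> \<le> \<Theta>"
    and bound_T: "\<And>a c. a \<in> profiles net \<Longrightarrow> c \<in> profiles net \<Longrightarrow> \<bar>transfer_cost net D a c\<bar> \<le> \<Theta>"
    and bound_V: "\<And>a c. a \<in> profiles net \<Longrightarrow> c \<in> profiles net \<Longrightarrow> \<bar>violation_cost net D a c\<bar> \<le> \<Theta>"
    and E_sub: "\<E> \<subseteq> distributions net"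
    and E_feasible: "\<And>p c. p \<in> \<E> \<Longrightarrow> c \<in> profiles net \<Longrightarrow> expect_VT net D p c - v \<le> 0"
    and slater_in: "Pslater \<in> \<E>"
    and eta_pos: "\<eta> > 0"
    and slater: "\<And>c. c \<in> profiles net \<Longrightarrow> expect_VT net D Pslater c - v \<le> - \<eta>"
    and alpha_pos: "\<alpha> > 0"
    and mu_pos: "\<mu> > 0"
    and requests: "\<And>t. b t \<in> profiles net"
    and lam1: "lam 1 = 0"
    and run: "saddle_point_run net D v \<alpha> \<mu> b P lam"
    and prob: "prob_space M"
    and generated: "generated_reservations net P M A"
    and delta: "0 < \<delta>" "\<delta> < 1"
    and T_pos: "T > 0"
    and K: "1 \<le> K" "K \<le> T"
    and Astar: "benchmark_action net D v b T K Astar"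
    and Pstar: "benchmark_distribution net D v b T K Pstar"
  shows "\<P>(w in M. realized_regret net (\<lambda>t. A t w) Astar T
            \<le> expected_regret net P Pstar T + sqrt (2 * ln (1 / \<delta>) * real T * \<Theta>\<^sup>2)) \<ge> 1 - \<delta>"
proof -
  interpret prob_space M by (fact prob)
  let ?\<epsilon> = "sqrt (2 * ln (1 / \<delta>) * real T * \<Theta>\<^sup>2)"
  let ?C = "\<lambda>w. \<Sum>t=1..T. reservation_cost net (A t w)"
  let ?m = "\<Sum>t=1..T. expect net (P t) (reservation_cost net)"
  have X: "A t \<in> measurable M (count_space (profiles net))" if "t \<in> {1..T}" for t
    using generated that by (simp add: generated_reservations_def)
  have [measurable]: "?C \<in> borel_measurable M"
    by (intro borel_measurable_sum measurable_compose[OF X]) auto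
  have regret: "realized_regret net (\<lambda>t. A t w) Astar T = ?C w - real T * reservation_cost net Astar" for w
    by (simp add: realized_regret_def sum_subtractf)
  have "1 - \<delta> \<le> \<P>(w in M. ?C w \<le> ?m + ?\<epsilon>)"
    by (rule sum_reservations_concentration[OF prob generated bound_R Theta_pos T_pos delta])
  also have "\<dots> \<le> \<P>(w in M. realized_regret net (\<lambda>t. A t w) Astar T
            \<le> expected_regret net P Pstar T + ?\<epsilon>)"
  proof (rule finite_measure_mono)
    show "{w \<in> space M. ?C w \<le> ?m + ?\<epsilon>} \<subseteq> {w \<in> space M. realized_regret net (\<lambda>t. A t w) Astar T
            \<le> expected_regret net P Pstar T + ?\<epsilon>}"
      using benchmark_distribution_le_action[OF Astar Pstar]
      by (auto simp: regret expected_regret_def sum_subtractf)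
    show "{w \<in> space M. realized_regret net (\<lambda>t. A t w) Astar T
            \<le> expected_regret net P Pstar T + ?\<epsilon>} \<in> events"
      unfolding regret by measurable
  qed
  finally show ?thesis .
qed

end
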